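(* Let $(X,d)$ be a CAT(0) space. Then: (1) $X$ is uniquely geodesic; (2) every local geodesic $\sigma:[a,b]\to X$ is a geodesic; (3) $X$ is contractible; (4) for every $\varepsilon>0$ and every $0<L<\infty$ there exists $\delta=\delta(\varepsilon,L)>0$ with the following property: for all $x,y\in X$ with $d(x,y)\le L$, if $m$ is the midpoint between $x$ and $y$ and $m'$ is any $\delta$-midpoint between $x$ and $y$, then $d(m,m')<\varepsilon$.
   Context: Metric spaces are nonempty. A geodesic in a metric space $(X,d)$ is a map $\gamma:[a,b]\to X$ for which there is $\lambda\ge 0$ with $d(\gamma(t),\gamma(t'))=\lambda|t-t'|$ for all $t,t'\in[a,b]$. A local geodesic is a continuous map $\sigma:[a,b]\to X$ such that every $t\in[a,b]$ has some $\varepsilon_t>0$ for which $\sigma|_{[a,b]\cap[t-\varepsilon_t,t+\varepsilon_t]}$ is a geodesic. $X$ is geodesic if any two points $x,y$ are joined by a geodesic $[0,1]\to X$, and uniquely geodesic if such a geodesic exists and is unique for all $x,y$. A geodesic triangle $\Delta=\Delta(x,y,z)$ consists of three points and a choice of three geodesic segments $[x,y],[y,z],[x,z]$ joining them. A comparison triangle $\overline\Delta=\overline\Delta(\overline x,\overline y,\overline z)$ is a triangle in the Euclidean plane $\mathbb{E}^2$ with the same side lengths; the comparison point of $p\in[x,y]$ is the point $\overline p\in[\overline x,\overline y]$ with $d(x,p)=d(\overline x,\overline p)$, and similarly for the other sides. A CAT(0) space is a geodesic metric space in which every geodesic triangle $\Delta$ satisfies $d(p,q)\le d(\overline p,\overline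 q)$ for all $p,q\in\Delta$ with comparison points $\overline p,\overline q\in\overline\Delta$. For $\varepsilon\ge0$, an $\varepsilon$-midpoint between $x$ and $y$ is a point $z$ with $d(x,z)\le \frac12 d(x,y)+\varepsilon$ and $d(y,z)\le\frac12 d(x,y)+\varepsilon$; a midpoint is a $0$-midpoint. *)

theory Defs
  imports "HOL-Analysis.Analysis"
begin

text \<open>
  A metric space is a set \<open>X\<close> in a type of class \<^class>\<open>metric_space\<close>, with the restricted
  distance; \<open>X = UNIV\<close> gives the metric space of the whole type. Paths are total functions on
  \<^typ>\<open>real\<close>, and only their values on the parameter set matter.
\<close>

definition geodesic_on :: "'a::metric_space set \<Rightarrow> real set \<Rightarrow> (real \<Rightarrow> 'a) \<Rightarrow> bool" where
  "geodesic_on X I \<gamma> \<longleftrightarrow>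
     \<gamma> ` I \<subseteq> X \<and> (\<exists>l\<ge>0. \<forall>t\<in>I. \<forall>t'\<in>I. dist (\<gamma> t) (\<gamma> t') = l * \<bar>t - t'\<bar>)"

definition local_geodesic_on :: "'a::metric_space set \<Rightarrow> real \<Rightarrow> real \<Rightarrow> (real \<Rightarrow> 'a) \<Rightarrow> bool" where
  "local_geodesic_on X a b \<sigma> \<longleftrightarrow>
     \<sigma> ` {a..b} \<subseteq> X \<and> continuous_on {a..b} \<sigma> \<and>
     (\<forall>t\<in>{a..b}. \<exists>\<epsilon>>0. geodesic_on X ({a..b} \<inter> {t - \<epsilon>..t + \<epsilon>}) \<sigma>)"

definition geodesic_joins ::
    "'a::metric_space set \<Rightarrow> 'a \<Rightarrow> 'a \<Rightarrow> (real \<Rightarrow> 'a) \<Rightarrow> bool" where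
  "geodesic_joins X x y \<gamma> \<longleftrightarrow> geodesic_on X {0..1} \<gamma> \<and> \<gamma> 0 = x \<and> \<gamma> 1 = y"

definition geodesic_space :: "'a::metric_space set \<Rightarrow> bool" where
  "geodesic_space X \<longleftrightarrow> (\<forall>x\<in>X. \<forall>y\<in>X. \<exists>\<gamma>. geodesic_joins X x y \<gamma>)"

definition uniquely_geodesic_space :: "'a::metric_space set \<Rightarrow> bool" where
  "uniquely_geodesic_space X \<longleftrightarrow>
     (\<forall>x\<in>X. \<forall>y\<in>X. \<exists>\<gamma>. geodesic_joins X x y \<gamma> \<and>
        (\<forall>\<gamma>'. geodesic_joins X x y \<gamma>' \<longrightarrow> (\<forall>t\<in>{0..1}. \<gamma>' t = \<gamma> t)))"

definition geodesic_segment ::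
    "'a::metric_space set \<Rightarrow> 'a \<Rightarrow> 'a \<Rightarrow> 'a set \<Rightarrow> bool" where
  "geodesic_segment X x y S \<longleftrightarrow> (\<exists>\<gamma>. geodesic_joins X x y \<gamma> \<and> S = \<gamma> ` {0..1})"

definition geodesic_triangle ::
    "'a::metric_space set \<Rightarrow> 'a \<Rightarrow> 'a \<Rightarrow> 'a \<Rightarrow> 'a set \<Rightarrow> 'a set \<Rightarrow> 'a set \<Rightarrow> bool" where
  "geodesic_triangle X x y z Sxy Syz Sxz \<longleftrightarrow>
     x \<in> X \<and> y \<in> X \<and> z \<in> X \<and>
     geodesic_segment X x y Sxy \<and> geodesic_segment X y z Syz \<and> geodesic_segment X x z Sxz"

definition comparison_triangle ::
    "'a::metric_space \<Rightarrow> 'a \<Rightarrow> 'a \<Rightarrow> real^2 \<Rightarrow> real^2 \<Rightarrow> real^2 \<Rightarrow> bool" where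
  "comparison_triangle x y z x' y' z' \<longleftrightarrow>
     dist x' y' = dist x y \<and> dist y' z' = dist y z \<and> dist x' z' = dist x z"

definition side_comparison_point ::
    "'a::metric_space \<Rightarrow> 'a set \<Rightarrow> real^2 \<Rightarrow> real^2 \<Rightarrow> 'a \<Rightarrow> real^2 \<Rightarrow> bool" where
  "side_comparison_point x S x' y' p p' \<longleftrightarrow>
     p \<in> S \<and> p' \<in> closed_segment x' y' \<and> dist x p = dist x' p'"

text \<open>
  A point lying on several sides of the triangle may have a different comparison point for each
  of them, so this is a relation.
\<close>

definition comparison_point ::
    "'a::metric_space \<Rightarrow> 'a \<Rightarrow> 'a set \<Rightarrow> 'a set \<Rightarrow> 'a set \<Rightarrow>
     real^2 \<Rightarrow> real^2 \<Rightarrow> real^2 \<Rightarrow> 'a \<Rightarrow> real^2 \<Rightarrow> bool" where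
  "comparison_point x y Sxy Syz Sxz x' y' z' p p' \<longleftrightarrow>
     side_comparison_point x Sxy x' y' p p' \<or>
     side_comparison_point y Syz y' z' p p' \<or>
     side_comparison_point x Sxz x' z' p p'"

definition CAT0_space :: "'a::metric_space set \<Rightarrow> bool" where
  "CAT0_space X \<longleftrightarrow>
     X \<noteq> {} \<and> geodesic_space X \<and>
     (\<forall>x y z Sxy Syz Sxz x' y' z' p q p' q'.
        geodesic_triangle X x y z Sxy Syz Sxz \<longrightarrow>
        comparison_triangle x y z x' y' z' \<longrightarrow>
        comparison_point x y Sxy Syz Sxz x' y' z' p p' \<longrightarrow>
        comparison_point x y Sxy Syz Sxz x' y' z' q q' \<longrightarrow>
        dist p q \<le> dist p' q')"

definition eps_midpoint :: "'a::metric_space set \<Rightarrow> real \<Rightarrow> 'a \<Rightarrow> 'a \<Rightarrow> 'a \<Rightarrow> bool" where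
  "eps_midpoint X \<epsilon> x y z \<longleftrightarrow>
     z \<in> X \<and> dist x z \<le> dist x y / 2 + \<epsilon> \<and> dist y z \<le> dist x y / 2 + \<epsilon>"

abbreviation is_midpoint :: "'a::metric_space set \<Rightarrow> 'a \<Rightarrow> 'a \<Rightarrow> 'a \<Rightarrow> bool" where
  "is_midpoint X x y z \<equiv> eps_midpoint X 0 x y z"

end

theory Submission imports Defs
begin

text \<open>
  Everything follows from one inequality. Comparing the triangle spanned by a point \<open>p\<close> and a
  geodesic \<open>\<gamma>\<close> from \<open>x\<close> to \<open>y\<close> with a Euclidean triangle, and evaluating the Euclidean side by
  Stewart's identity, gives

    \<open>d(p, \<gamma> t)\<^sup>2 \<le> (1 - t) d(p,x)\<^sup>2 + t d(p,y)\<^sup>2 - t (1 - t) d(x,y)\<^sup>2\<close>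

  (\<open>CAT0_stewart\<close>): squared distance to a point is at least as convex along a geodesic as it is
  along a Euclidean line.

  \<^item> If \<open>p\<close> is the point with parameter \<open>t\<close> on a second geodesic from \<open>x\<close> to \<open>y\<close>, the right-hand
    side vanishes, so geodesics are unique.

  \<^item> If \<open>p\<close> is a \<open>\<delta>\<close>-midpoint and \<open>t = 1/2\<close>, the right-hand side is at most
    \<open>d(x,y) \<delta> + \<delta>\<^sup>2\<close>. For \<open>\<delta> = 0\<close> this identifies the midpoint with \<open>\<gamma> (1/2)\<close>; in general it
    is small uniformly for \<open>d(x,y) \<le> L\<close>.

  \<^item> Applied twice, the inequality shows that two geodesics issuing from a common point satisfy
    \<open>d(\<gamma> t, \<gamma>' t) \<le> t d(\<gamma> 1, \<gamma>' 1)\<close>. Hence the geodesic from a base point depends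
    continuously on its endpoint, and moving along these geodesics is a homotopy from a constant
    map to the identity.

  \<^item> Two geodesic pieces of a path that overlap in a nondegenerate interval combine to a longer
    geodesic (\<open>constant_speed_glue\<close>): the inequality, applied at a point of the overlap, bounds the
    distance of the far endpoints from below by the length of the path between them. Compactness
    of the parameter interval then makes every local geodesic a geodesic.
\<close>

section \<open>Euclidean comparison triangles\<close>

lemma dist_real2: "dist p q = sqrt ((p$1 - q$1)\<^sup>2 + (p$2 - q$2)\<^sup>2)" for p q :: "real^2"
  by (simp add: dist_vec_def L2_set_def sum_2 dist_real_def)

text \<open>
  Put the first side on the horizontal axis. The law of cosines then forces the abscissa \<open>u\<close> of the
  third vertex, and the triangle inequalities say exactly that \<open>u\<^sup>2 \<le> c\<^sup>2\<close>, so that an ordinate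
  exists.
\<close>

lemma euclidean_triangle_exists:
  fixes a b c :: real
  assumes "0 \<le> a" "0 \<le> b" "0 \<le> c" "a \<le> b + c" "b \<le> a + c" "c \<le> a + b"
  shows "\<exists>x y z :: real^2. dist x y = a \<and> dist y z = b \<and> dist x z = c"
proof (cases "a = 0")
  case True
  then have "b = c" using assms by simp
  have "dist (0::real^2) (vector [c, 0]) = c"
    using assms by (simp add: dist_real2)
  then show ?thesis using True \<open>b = c\<close>
    by (intro exI[of _ 0] exI[of _ "vector [c, 0]"]) auto
next
  case False
  then have a: "a > 0" using assms by simp
  define u where "u = (a\<^sup>2 + c\<^sup>2 - b\<^sup>2) / (2 * a)"
  have au: "2 * a * u = a\<^sup>2 + c\<^sup>2 - b\<^sup>2" using a by (simp add: u_def)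
  have "b\<^sup>2 \<le> (a + c)\<^sup>2" using assms by (intro power_mono) auto
  moreover have "(a - c)\<^sup>2 \<le> b\<^sup>2" using assms by (intro abs_le_square_iff[THEN iffD1]) auto
  ultimately have "\<bar>2 * a * u\<bar> \<le> 2 * a * c"
    unfolding au by (simp add: power2_sum power2_diff)
  then have "\<bar>u\<bar> \<le> \<bar>c\<bar>" using a assms(3) by (simp add: abs_mult)
  then have uc: "u\<^sup>2 \<le> c\<^sup>2" by (simp add: abs_le_square_iff)
  define z :: "real^2" where "z = vector [u, sqrt (c\<^sup>2 - u\<^sup>2)]"
  have "(a - u)\<^sup>2 + (c\<^sup>2 - u\<^sup>2) = b\<^sup>2" using au by (simp add: power2_diff)
  then have "dist (vector [a, 0]) z = b"
    using assms uc by (simp add: dist_real2 z_def)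
  moreover have "dist 0 z = c" using assms uc by (simp add: dist_real2 z_def)
  moreover have "dist (0::real^2) (vector [a, 0]) = a"
    using assms by (simp add: dist_real2)
  ultimately show ?thesis by blast
qed

lemma comparison_triangle_exists: "\<exists>x' y' z'. comparison_triangle x y z x' y' z'"
  unfolding comparison_triangle_def
  using dist_triangle[of x y z] dist_triangle[of y z x] dist_triangle[of x z y]
  by (intro euclidean_triangle_exists) (simp_all add: dist_commute)

lemma stewart_identity:
  fixes x y p :: "'a::real_inner"
  shows "(dist p ((1 - t) *\<^sub>R x + t *\<^sub>R y))\<^sup>2
    = (1 - t) * (dist p x)\<^sup>2 + t * (dist p y)\<^sup>2 - t * (1 - t) * (dist x y)\<^sup>2"
proof -
  define u v where "u = p - x" and "v = p - y"
  have "p - ((1 - t) *\<^sub>R x + t *\<^sub>R y) = (1 - t) *\<^sub>R u + t *\<^sub>R v" "x - y = v - u"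
    by (simp_all add: u_def v_def algebra_simps)
  moreover have "(norm ((1 - t) *\<^sub>R u + t *\<^sub>R v))\<^sup>2
      = (1 - t) * (norm u)\<^sup>2 + t * (norm v)\<^sup>2 - t * (1 - t) * (norm (v - u))\<^sup>2"
    unfolding power2_norm_eq_inner inner_add_left inner_add_right inner_diff_left inner_diff_right
      inner_scaleR_left inner_scaleR_right inner_commute[of v u]
    by algebra
  ultimately show ?thesis by (simp add: dist_norm u_def v_def)
qed

section \<open>The comparison inequality in a CAT(0) space\<close>

lemma geodesic_joins_dist:
  assumes "geodesic_joins X x y \<gamma>" "s \<in> {0..1}" "t \<in> {0..1}"
  shows "dist (\<gamma> s) (\<gamma> t) = dist x y * \<bar>s - t\<bar>"
proof -
  from assms(1) obtain l where
    l: "\<forall>t\<in>{0..1}. \<forall>t'\<in>{0..1}. dist (\<gamma> t) (\<gamma> t') = l * \<bar>t - t'\<bar>" and "\<gamma> 0 = x" "\<gamma> 1 = y"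
    by (auto simp: geodesic_joins_def geodesic_on_def)
  from l have "dist (\<gamma> 0) (\<gamma> 1) = l" by fastforce
  then show ?thesis using l assms(2,3) \<open>\<gamma> 0 = x\<close> \<open>\<gamma> 1 = y\<close> by blast
qed

lemma geodesic_joins_in:
  assumes "geodesic_joins X x y \<gamma>" "t \<in> {0..1}"
  shows "\<gamma> t \<in> X"
  using assms by (auto simp: geodesic_joins_def geodesic_on_def)

lemma geodesic_joins_dist_start:
  assumes "geodesic_joins X x y \<gamma>" "t \<in> {0..1}"
  shows "dist x (\<gamma> t) = t * dist x y"
  using geodesic_joins_dist[OF assms(1), of 0 t] assms by (simp add: geodesic_joins_def)

lemma geodesic_joins_dist_end:
  assumes "geodesic_joins X x y \<gamma>" "t \<in> {0..1}"
  shows "dist y (\<gamma> t) = (1 - t) * dist x y"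
  using geodesic_joins_dist[OF assms(1), of 1 t] assms by (simp add: geodesic_joins_def)

lemma CAT0_geodesic_exists:
  assumes "CAT0_space X" "x \<in> X" "y \<in> X"
  shows "\<exists>\<gamma>. geodesic_joins X x y \<gamma>"
  using assms by (simp add: CAT0_space_def geodesic_space_def)

text \<open>
  In a comparison triangle, \<open>\<gamma> t\<close> corresponds to \<open>(1 - t) x' + t y'\<close> and \<open>p\<close> to the third vertex,
  so the claim is the CAT(0) inequality followed by Stewart's identity.
\<close>

lemma CAT0_stewart:
  assumes X: "CAT0_space X" and p: "p \<in> X" and \<gamma>: "geodesic_joins X x y \<gamma>" and t: "t \<in> {0..1}"
  shows "(dist p (\<gamma> t))\<^sup>2 \<le> (1 - t) * (dist p x)\<^sup>2 + t * (dist p y)\<^sup>2 - t * (1 - t) * (dist x y)\<^sup>2"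
proof -
  have xy: "x \<in> X" "y \<in> X"
    using geodesic_joins_in[OF \<gamma>, of 0] geodesic_joins_in[OF \<gamma>, of 1] \<gamma>
    by (auto simp: geodesic_joins_def)
  obtain \<alpha> \<beta> where \<alpha>: "geodesic_joins X y p \<alpha>" and \<beta>: "geodesic_joins X x p \<beta>"
    using CAT0_geodesic_exists[OF X] p xy by blast
  have tri: "geodesic_triangle X x y p (\<gamma> ` {0..1}) (\<alpha> ` {0..1}) (\<beta> ` {0..1})"
    using \<alpha> \<beta> \<gamma> p xy by (auto simp: geodesic_triangle_def geodesic_segment_def)
  obtain x' y' p' where cmp: "comparison_triangle x y p x' y' p'"
    using comparison_triangle_exists by blast
  then have d: "dist x' y' = dist x y" "dist y' p' = dist y p" "dist x' p' = dist x p"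
    by (auto simp: comparison_triangle_def)
  define q where "q = (1 - t) *\<^sub>R x' + t *\<^sub>R y'"
  have "x' - q = t *\<^sub>R (x' - y')" by (simp add: q_def algebra_simps)
  then have "dist x' q = t * dist x' y'" using t by (simp add: dist_norm)
  moreover have "q \<in> closed_segment x' y'" using t by (auto simp: q_def closed_segment_def)
  ultimately have "side_comparison_point x (\<gamma> ` {0..1}) x' y' (\<gamma> t) q"
    using t d geodesic_joins_dist_start[OF \<gamma> t] by (auto simp: side_comparison_point_def)
  moreover have "side_comparison_point x (\<beta> ` {0..1}) x' p' p p'"
    using \<beta> d by (force simp: side_comparison_point_def geodesic_joins_def)
  ultimately have "dist p (\<gamma> t) \<le> dist p' q"
    using X tri cmp unfolding CAT0_space_def comparison_point_def by blast
  then have "(dist p (\<gamma> t))\<^sup>2 \<le> (dist p' q)\<^sup>2" by (intro power_mono) auto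
  also have "\<dots> = (1 - t) * (dist p x)\<^sup>2 + t * (dist p y)\<^sup>2 - t * (1 - t) * (dist x y)\<^sup>2"
    unfolding q_def stewart_identity using d by (simp add: dist_commute)
  finally show ?thesis .
qed

section \<open>Uniqueness of geodesics and stability of midpoints\<close>

lemma CAT0_geodesic_unique:
  assumes X: "CAT0_space X" and \<gamma>: "geodesic_joins X x y \<gamma>" and \<gamma>': "geodesic_joins X x y \<gamma>'"
    and t: "t \<in> {0..1}"
  shows "\<gamma>' t = \<gamma> t"
proof -
  have "(dist (\<gamma>' t) (\<gamma> t))\<^sup>2
      \<le> (1 - t) * (t * dist x y)\<^sup>2 + t * ((1 - t) * dist x y)\<^sup>2 - t * (1 - t) * (dist x y)\<^sup>2"
    using CAT0_stewart[OF X geodesic_joins_in[OF \<gamma>' t] \<gamma> t]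
      geodesic_joins_dist_start[OF \<gamma>' t] geodesic_joins_dist_end[OF \<gamma>' t]
    by (simp add: dist_commute)
  also have "\<dots> = 0" by (simp add: power2_eq_square algebra_simps)
  finally show ?thesis by simp
qed

lemma CAT0_uniquely_geodesic:
  assumes X: "CAT0_space X"
  shows "uniquely_geodesic_space X"
  unfolding uniquely_geodesic_space_def
proof (intro ballI)
  fix x y assume "x \<in> X" "y \<in> X"
  then obtain \<gamma> where "geodesic_joins X x y \<gamma>"
    using CAT0_geodesic_exists[OF X] by blast
  then show "\<exists>\<gamma>. geodesic_joins X x y \<gamma> \<and>
      (\<forall>\<gamma>'. geodesic_joins X x y \<gamma>' \<longrightarrow> (\<forall>t\<in>{0..1}. \<gamma>' t = \<gamma> t))"
    using CAT0_geodesic_unique[OF X] by blast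
qed

lemma CAT0_eps_midpoint_near_centre:
  assumes X: "CAT0_space X" and \<gamma>: "geodesic_joins X x y \<gamma>" and m: "eps_midpoint X \<delta> x y m"
  shows "(dist m (\<gamma> (1/2)))\<^sup>2 \<le> dist x y * \<delta> + \<delta>\<^sup>2"
proof -
  have "dist x m \<le> dist x y / 2 + \<delta>" "dist y m \<le> dist x y / 2 + \<delta>" and mX: "m \<in> X"
    using m by (auto simp: eps_midpoint_def)
  then have *: "(dist m x)\<^sup>2 \<le> (dist x y / 2 + \<delta>)\<^sup>2" "(dist m y)\<^sup>2 \<le> (dist x y / 2 + \<delta>)\<^sup>2"
    by (simp_all add: dist_commute power_mono)
  have "(dist m (\<gamma> (1/2)))\<^sup>2 \<le> (dist m x)\<^sup>2 / 2 + (dist m y)\<^sup>2 / 2 - (dist x y)\<^sup>2 / 4"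
    using CAT0_stewart[OF X mX \<gamma>, of "1/2"] by simp
  also have "\<dots> \<le> (dist x y / 2 + \<delta>)\<^sup>2 - (dist x y)\<^sup>2 / 4"
    using * by linarith
  also have "\<dots> = dist x y * \<delta> + \<delta>\<^sup>2" by (simp add: power2_eq_square field_simps)
  finally show ?thesis .
qed

lemma CAT0_midpoint_stability:
  assumes X: "CAT0_space X" and "0 < \<epsilon>" "0 < L"
  shows "\<exists>\<delta>>0. \<forall>x\<in>X. \<forall>y\<in>X. dist x y \<le> L \<longrightarrow>
    (\<forall>m m'. is_midpoint X x y m \<longrightarrow> eps_midpoint X \<delta> x y m' \<longrightarrow> dist m m' < \<epsilon>)"
proof -
  \<comment> \<open>chosen so that \<open>L \<delta> + \<delta>\<^sup>2 \<le> (L + 1) \<delta> \<le> \<epsilon>\<^sup>2 / 2\<close>\<close>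
  define \<delta> where "\<delta> = min 1 (\<epsilon>\<^sup>2 / (2 * (L + 1)))"
  have \<delta>: "\<delta> > 0" "\<delta> \<le> 1" using assms by (auto simp: \<delta>_def)
  have "\<delta> \<le> \<epsilon>\<^sup>2 / (2 * (L + 1))" by (simp add: \<delta>_def)
  then have \<delta>L: "(L + 1) * \<delta> \<le> \<epsilon>\<^sup>2 / 2" using assms by (simp add: field_simps)
  have "dist m m' < \<epsilon>" if x: "x \<in> X" and y: "y \<in> X" and xy: "dist x y \<le> L"
    and m: "is_midpoint X x y m" and m': "eps_midpoint X \<delta> x y m'" for x y m m'
  proof -
    obtain \<gamma> where \<gamma>: "geodesic_joins X x y \<gamma>"
      using CAT0_geodesic_exists[OF X x y] by blast
    have "m = \<gamma> (1/2)" using CAT0_eps_midpoint_near_centre[OF X \<gamma> m] by simp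
    then have "(dist m m')\<^sup>2 \<le> dist x y * \<delta> + \<delta>\<^sup>2"
      using CAT0_eps_midpoint_near_centre[OF X \<gamma> m'] by (simp add: dist_commute)
    also have "\<dots> \<le> L * \<delta> + 1 * \<delta>"
      unfolding power2_eq_square using \<delta> xy by (intro add_mono mult_right_mono) auto
    also have "\<dots> = (L + 1) * \<delta>" by (simp add: algebra_simps)
    also have "\<dots> \<le> \<epsilon>\<^sup>2 / 2" by (rule \<delta>L)
    also have "\<dots> < \<epsilon>\<^sup>2" using assms by simp
    finally show ?thesis using assms by (simp add: power2_less_imp_less)
  qed
  then show ?thesis using \<delta> by blast
qed

section \<open>Contractibility\<close>

text \<open>
  Apply the comparison inequality to \<open>\<gamma> t\<close> and the geodesic \<open>\<beta>\<close>, and then to \<open>z\<close> and the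
  geodesic \<open>\<gamma>\<close>: everything but \<open>t\<^sup>2 d(y,z)\<^sup>2\<close> cancels.
\<close>

lemma CAT0_geodesics_from_common_point:
  assumes X: "CAT0_space X" and \<gamma>: "geodesic_joins X x y \<gamma>" and \<beta>: "geodesic_joins X x z \<beta>"
    and t: "t \<in> {0..1}"
  shows "dist (\<gamma> t) (\<beta> t) \<le> t * dist y z"
proof -
  have z: "z \<in> X" using geodesic_joins_in[OF \<beta>, of 1] \<beta> by (simp add: geodesic_joins_def)
  have "(dist (\<gamma> t) (\<beta> t))\<^sup>2
      \<le> (1 - t) * (t * dist x y)\<^sup>2 + t * (dist z (\<gamma> t))\<^sup>2 - t * (1 - t) * (dist x z)\<^sup>2"
    using CAT0_stewart[OF X geodesic_joins_in[OF \<gamma> t] \<beta> t] geodesic_joins_dist_start[OF \<gamma> t]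
    by (simp add: dist_commute)
  also have "\<dots> \<le> (1 - t) * (t * dist x y)\<^sup>2
      + t * ((1 - t) * (dist x z)\<^sup>2 + t * (dist y z)\<^sup>2 - t * (1 - t) * (dist x y)\<^sup>2)
      - t * (1 - t) * (dist x z)\<^sup>2"
    using CAT0_stewart[OF X z \<gamma> t] t
    by (intro add_mono diff_mono mult_left_mono) (auto simp: dist_commute)
  also have "\<dots> = (t * dist y z)\<^sup>2" by (simp add: power2_eq_square algebra_simps)
  finally have "(dist (\<gamma> t) (\<beta> t))\<^sup>2 \<le> (t * dist y z)\<^sup>2" .
  then show ?thesis by (rule power2_le_imp_le) (use t in simp)
qed

text \<open>
  The homotopy sends \<open>(t, x)\<close> to the point with parameter \<open>t\<close> on the geodesic from a base point to
  \<open>x\<close>. For continuity, \<open>h (s, y)\<close> and \<open>h (t, x)\<close> are compared through \<open>h (s, x)\<close>: the first step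
  changes the endpoint, the second moves along a single geodesic.
\<close>

lemma CAT0_contractible:
  assumes X: "CAT0_space X"
  shows "contractible X"
proof -
  obtain base where base: "base \<in> X" using X by (auto simp: CAT0_space_def)
  have "\<forall>x\<in>X. \<exists>\<gamma>. geodesic_joins X base x \<gamma>"
    using CAT0_geodesic_exists[OF X base] by blast
  then obtain g where g: "\<And>x. x \<in> X \<Longrightarrow> geodesic_joins X base x (g x)" by metis
  define h where "h = (\<lambda>(t :: real, x). g x t)"
  have "continuous_on ({0..1} \<times> X) h"
    unfolding continuous_on_def
  proof
    fix w :: "real \<times> 'a" assume "w \<in> {0..1} \<times> X"
    then obtain t x where w: "w = (t, x)" and t: "t \<in> {0..1}" and x: "x \<in> X" by auto
    let ?F = "at w within {0..1} \<times> X"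
    let ?b = "\<lambda>v. dist base x * \<bar>fst v - t\<bar> + dist (snd v) x"
    have bound: "dist (h v) (h w) \<le> ?b v" if v_in: "v \<in> {0..1} \<times> X" for v
    proof -
      obtain s y where v: "v = (s, y)" and s: "s \<in> {0..1}" and y: "y \<in> X"
        using v_in by auto
      have "dist (g y s) (g x s) \<le> s * dist y x"
        by (rule CAT0_geodesics_from_common_point[OF X g[OF y] g[OF x] s])
      also have "\<dots> \<le> dist y x" using s by (simp add: mult_left_le_one_le)
      finally show ?thesis
        using dist_triangle[of "g y s" "g x t" "g x s"] geodesic_joins_dist[OF g[OF x] s t]
        by (simp add: h_def v w)
    qed
    have "(?b \<longlongrightarrow> dist base x * \<bar>fst w - t\<bar> + dist (snd w) x) ?F"
      by (intro tendsto_intros)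
    then have "(?b \<longlongrightarrow> 0) ?F" by (simp add: w)
    moreover have "\<forall>\<^sub>F v in ?F. dist (h v) (h w) \<le> ?b v"
      using bound by (auto simp: eventually_at_filter)
    ultimately have "((\<lambda>v. dist (h v) (h w)) \<longlongrightarrow> 0) ?F"
      using Lim_null_comparison[of "\<lambda>v. dist (h v) (h w)" ?b ?F] by simp
    then show "(h \<longlongrightarrow> h w) ?F" by (rule tendsto_dist_iff[THEN iffD2])
  qed
  moreover have "h ` ({0..1} \<times> X) \<subseteq> X" using geodesic_joins_in[OF g] by (auto simp: h_def)
  ultimately have "continuous_map (prod_topology (top_of_set {0..1}) (top_of_set X)) (top_of_set X) h"
    by (simp add: image_subset_iff_funcset)
  moreover have "h (0, x) = base" "h (1, x) = x" if "x \<in> X" for x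
    using g[OF that] by (simp_all add: h_def geodesic_joins_def)
  ultimately have "homotopic_with_canon (\<lambda>_. True) X X (\<lambda>_. base) id"
    unfolding homotopic_with[where P = "\<lambda>_. True", simplified] by auto
  then show ?thesis unfolding contractible_def using homotopic_with_symD by blast
qed

section \<open>Local geodesics\<close>

text \<open>
  Fixing the speed, rather than asserting its existence as in \<^const>\<open>geodesic_on\<close>, makes it possible
  to say that two pieces of a path have the same speed.
\<close>

definition constant_speed :: "real \<Rightarrow> real set \<Rightarrow> (real \<Rightarrow> 'a::metric_space) \<Rightarrow> bool" where
  "constant_speed l I \<sigma> \<longleftrightarrow> (\<forall>s\<in>I. \<forall>t\<in>I. dist (\<sigma> s) (\<sigma> t) = l * \<bar>s - t\<bar>)"

lemma constant_speed_subset: "constant_speed l I \<sigma> \<Longrightarrow> J \<subseteq> I \<Longrightarrow> constant_speed l J \<sigma>"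
  unfolding constant_speed_def by blast

lemma constant_speed_joins:
  assumes cs: "constant_speed l {u..v} \<sigma>" and "0 \<le> l" "u \<le> v" "\<sigma> ` {u..v} \<subseteq> X"
  shows "geodesic_joins X (\<sigma> u) (\<sigma> v) (\<lambda>r. \<sigma> (u + r * (v - u)))"
proof -
  have in_uv: "u + r * (v - u) \<in> {u..v}" if "r \<in> {0..1}" for r
    using that assms(3) mult_left_le_one_le[of "v - u" r] by auto
  have "dist (\<sigma> (u + r * (v - u))) (\<sigma> (u + r' * (v - u))) = (l * (v - u)) * \<bar>r - r'\<bar>"
    if "r \<in> {0..1}" "r' \<in> {0..1}" for r r'
  proof -
    have "(u + r * (v - u)) - (u + r' * (v - u)) = (r - r') * (v - u)"
      by (simp add: algebra_simps)
    then show ?thesis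
      using cs in_uv[OF that(1)] in_uv[OF that(2)] assms(3)
      by (simp add: constant_speed_def abs_mult)
  qed
  moreover have "0 \<le> l * (v - u)" using assms by simp
  moreover have "(\<lambda>r. \<sigma> (u + r * (v - u))) ` {0..1} \<subseteq> X" using in_uv assms(4) by blast
  ultimately have "geodesic_on X {0..1} (\<lambda>r. \<sigma> (u + r * (v - u)))"
    unfolding geodesic_on_def by blast
  then show ?thesis by (simp add: geodesic_joins_def)
qed

text \<open>
  For \<open>s < b < c < t\<close>, apply the comparison inequality to \<open>\<sigma> s\<close> and the geodesic from \<open>\<sigma> b\<close> to
  \<open>\<sigma> t\<close>, at the parameter of \<open>\<sigma> c\<close>. All distances but \<open>d(\<sigma> s, \<sigma> t)\<close> are known and agree with those
  of points on a line, where the inequality is an equality. Since \<open>d(\<sigma> s, \<sigma> t)\<close> enters with a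
  positive weight, it is at least \<open>l (t - s)\<close>.
\<close>

lemma constant_speed_glue:
  assumes X: "CAT0_space X" and l: "0 \<le> l" and im: "\<sigma> ` {a..d} \<subseteq> X"
    and ord: "a \<le> b" "b < c" "c \<le> d"
    and ac: "constant_speed l {a..c} \<sigma>" and bd: "constant_speed l {b..d} \<sigma>"
  shows "constant_speed l {a..d} \<sigma>"
proof -
  have far: "dist (\<sigma> s) (\<sigma> t) = l * (t - s)" if s: "a \<le> s" "s < b" and t: "c < t" "t \<le> d" for s t
  proof (rule antisym)
    have sb: "dist (\<sigma> s) (\<sigma> b) = l * (b - s)" and sc: "dist (\<sigma> s) (\<sigma> c) = l * (c - s)"
      using ac s ord by (auto simp: constant_speed_def)
    have bt: "dist (\<sigma> b) (\<sigma> t) = l * (t - b)"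
      using bd t ord by (auto simp: constant_speed_def)
    show "dist (\<sigma> s) (\<sigma> t) \<le> l * (t - s)"
      using dist_triangle[of "\<sigma> s" "\<sigma> t" "\<sigma> b"] sb bt by (simp add: algebra_simps)
    define r where "r = (c - b) / (t - b)"
    have r: "0 < r" "r \<le> 1" using t ord by (auto simp: r_def)
    have c: "c = b + r * (t - b)" using t ord by (simp add: r_def)
    have "constant_speed l {b..t} \<sigma>"
      by (rule constant_speed_subset[OF bd]) (use t in auto)
    then have \<gamma>: "geodesic_joins X (\<sigma> b) (\<sigma> t) (\<lambda>r. \<sigma> (b + r * (t - b)))"
      by (rule constant_speed_joins) (use l t ord im in force)+
    have "\<sigma> s \<in> X" using im s ord by auto
    from CAT0_stewart[OF X this \<gamma>, of r]
    have "(l * (c - s))\<^sup>2 \<le> (1 - r) * (l * (b - s))\<^sup>2 + r * (dist (\<sigma> s) (\<sigma> t))\<^sup>2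
        - r * (1 - r) * (l * (t - b))\<^sup>2"
      using r by (simp add: c[symmetric] sb sc bt)
    moreover have "(l * (c - s))\<^sup>2 = (1 - r) * (l * (b - s))\<^sup>2 + r * (l * (t - s))\<^sup>2
        - r * (1 - r) * (l * (t - b))\<^sup>2"
      unfolding c by (simp add: power2_eq_square algebra_simps)
    ultimately have "r * (l * (t - s))\<^sup>2 \<le> r * (dist (\<sigma> s) (\<sigma> t))\<^sup>2" by linarith
    then have "(l * (t - s))\<^sup>2 \<le> (dist (\<sigma> s) (\<sigma> t))\<^sup>2" using r by simp
    then show "l * (t - s) \<le> dist (\<sigma> s) (\<sigma> t)" by (rule power2_le_imp_le) simp
  qed
  have *: "dist (\<sigma> s) (\<sigma> t) = l * (t - s)" if "a \<le> s" "s \<le> t" "t \<le> d" for s t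
  proof -
    consider "t \<le> c" | "b \<le> s" | "s < b" "c < t" by linarith
    then show ?thesis
      using far ac bd that by cases (auto simp: constant_speed_def)
  qed
  show ?thesis
    unfolding constant_speed_def
  proof (intro ballI)
    fix s t assume "s \<in> {a..d}" "t \<in> {a..d}"
    then show "dist (\<sigma> s) (\<sigma> t) = l * \<bar>s - t\<bar>"
      using *[of s t] *[of t s] by (cases "s \<le> t") (auto simp: dist_commute)
  qed
qed

text \<open>
  The property propagated over \<open>[a,b]\<close> by bisection is that \<open>\<sigma>\<close> is a geodesic on a
  neighbourhood of \<open>[u,v]\<close> in \<open>[a,b]\<close>. With \<open>[u,v]\<close> alone, adjacent pieces would share a single
  point only, and \<open>constant_speed_glue\<close> needs a nondegenerate overlap (a path may turn at a point).
\<close>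

lemma CAT0_local_geodesic_is_geodesic:
  assumes X: "CAT0_space X" and ab: "a \<le> b" and loc: "local_geodesic_on X a b \<sigma>"
  shows "geodesic_on X {a..b} \<sigma>"
proof (cases "a = b")
  case True
  then show ?thesis using loc by (auto simp: local_geodesic_on_def geodesic_on_def)
next
  case False
  then have ab: "a < b" using ab by simp
  have im: "\<sigma> ` {a..b} \<subseteq> X" using loc by (simp add: local_geodesic_on_def)
  define P where "P u v \<longleftrightarrow> (a \<le> u \<longrightarrow> v \<le> b \<longrightarrow>
      (\<exists>\<eta>>0. \<exists>l\<ge>0. constant_speed l {max a (u - \<eta>)..min b (v + \<eta>)} \<sigma>))" for u v
  have "P a b"
  proof (rule Bolzano[OF less_imp_le[OF ab]])
    fix u v w assume P: "P u v" "P v w" and uvw: "u \<le> v" "v \<le> w"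
    show "P u w"
      unfolding P_def
    proof (intro impI)
      assume uw: "a \<le> u" "w \<le> b"
      obtain \<eta>1 l where 1: "\<eta>1 > 0" "l \<ge> 0" "constant_speed l {max a (u - \<eta>1)..min b (v + \<eta>1)} \<sigma>"
        using P uvw uw unfolding P_def by auto
      obtain \<eta>2 l' where 2: "\<eta>2 > 0" "constant_speed l' {max a (v - \<eta>2)..min b (w + \<eta>2)} \<sigma>"
        using P uvw uw unfolding P_def by auto
      define \<eta> where "\<eta> = min \<eta>1 \<eta>2"
      have \<eta>: "\<eta> > 0" "\<eta> \<le> \<eta>1" "\<eta> \<le> \<eta>2" using 1 2 by (auto simp: \<eta>_def)
      define p q where "p = max a (v - \<eta>)" and "q = min b (v + \<eta>)"
      have pq: "p < q" using ab uvw uw \<eta> by (auto simp: p_def q_def)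
      have left: "constant_speed l {max a (u - \<eta>)..q} \<sigma>"
        by (rule constant_speed_subset[OF 1(3)]) (use \<eta> in \<open>auto simp: q_def\<close>)
      have right: "constant_speed l' {p..min b (w + \<eta>)} \<sigma>"
        by (rule constant_speed_subset[OF 2(2)]) (use \<eta> in \<open>auto simp: p_def\<close>)
      have ord: "max a (u - \<eta>) \<le> p" "q \<le> min b (w + \<eta>)"
        using uvw by (auto simp: p_def q_def)
      \<comment> \<open>the two speeds agree because both are measured on \<open>[p,q]\<close>\<close>
      have "dist (\<sigma> p) (\<sigma> q) = l * \<bar>p - q\<bar>"
        using left pq ord unfolding constant_speed_def by simp
      moreover have "dist (\<sigma> p) (\<sigma> q) = l' * \<bar>p - q\<bar>"
        using right pq ord unfolding constant_speed_def by simp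
      ultimately have "l' = l" using pq by simp
      then have "constant_speed l {max a (u - \<eta>)..min b (w + \<eta>)} \<sigma>"
        using im by (intro constant_speed_glue[OF X 1(2) _ ord(1) pq ord(2) left]) (use right in auto)
      then show "\<exists>\<eta>>0. \<exists>l\<ge>0. constant_speed l {max a (u - \<eta>)..min b (w + \<eta>)} \<sigma>"
        using \<eta> 1 by blast
    qed
  next
    fix x assume "a \<le> x" "x \<le> b"
    then have "x \<in> {a..b}" by simp
    then obtain \<epsilon> where "\<epsilon> > 0" and geo: "geodesic_on X ({a..b} \<inter> {x - \<epsilon>..x + \<epsilon>}) \<sigma>"
      using loc unfolding local_geodesic_on_def by blast
    moreover from geo obtain l where "l \<ge> 0" "constant_speed l ({a..b} \<inter> {x - \<epsilon>..x + \<epsilon>}) \<sigma>"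
      unfolding geodesic_on_def constant_speed_def by blast
    ultimately have \<epsilon>: "\<epsilon> > 0" "l \<ge> 0" "constant_speed l ({a..b} \<inter> {x - \<epsilon>..x + \<epsilon>}) \<sigma>"
      by auto
    have "P u v" if "u \<le> x" "x \<le> v" "v - u < \<epsilon> / 2" for u v
    proof -
      have "constant_speed l {max a (u - \<epsilon> / 2)..min b (v + \<epsilon> / 2)} \<sigma>"
        by (rule constant_speed_subset[OF \<epsilon>(3)]) (use that in auto)
      then show ?thesis using \<epsilon> unfolding P_def by (metis half_gt_zero)
    qed
    then show "\<exists>d>0. \<forall>u v. u \<le> x \<and> x \<le> v \<and> v - u < d \<longrightarrow> P u v"
      using \<epsilon>(1) by (intro exI[of _ "\<epsilon> / 2"]) auto
  qed
  then obtain \<eta> l where "\<eta> > 0" "l \<ge> 0" "constant_speed l {max a (a - \<eta>)..min b (b + \<eta>)} \<sigma>"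
    unfolding P_def by auto
  then show ?thesis using im by (auto simp: geodesic_on_def constant_speed_def)
qed

theorem proposition3p1p4:
  fixes X :: "'a::metric_space set"
  assumes "CAT0_space X"
  shows "uniquely_geodesic_space X
    \<and> (\<forall>a b \<sigma>. a \<le> b \<longrightarrow> local_geodesic_on X a b \<sigma> \<longrightarrow> geodesic_on X {a..b} \<sigma>)
    \<and> contractible X
    \<and> (\<forall>\<epsilon>>0. \<forall>L>0. \<exists>\<delta>>0. \<forall>x\<in>X. \<forall>y\<in>X. dist x y \<le> L \<longrightarrow>
         (\<forall>m m'. is_midpoint X x y m \<longrightarrow> eps_midpoint X \<delta> x y m' \<longrightarrow> dist m m' < \<epsilon>))"
  using CAT0_uniquely_geodesic[OF assms] CAT0_local_geodesic_is_geodesic[OF assms]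
    CAT0_contractible[OF assms] CAT0_midpoint_stability[OF assms]
  by blast

end
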